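(* Let $d\ge 1$ and $k\ge 1$ be integers. If $S\subset\mathbb{R}^d$ is a $d$-dimensional $k$-crystal, then its Helly number satisfies $h(S)\leq k\,2^d$.
   Context: Helly number: for a non-empty set $S\subseteq\mathbb{R}^d$, the $S$-Helly number $h(S)$ is the minimal positive integer $n$ with the following property: for every finite family $\mathcal{F}$ of convex sets in $\mathbb{R}^d$ with at least $n$ members, if every $n$ sets from $\mathcal{F}$ have a common point belonging to $S$, then all sets from $\mathcal{F}$ have a common point belonging to $S$. If no such $n$ exists, $h(S)=\infty$. Crystal: let $\Lambda$ be a full rank lattice in $\mathbb{R}^d$, i.e. the set of all integer linear combinations of a basis of $\mathbb{R}^d$, and let $\mathbf{t}_1,\ldots,\mathbf{t}_k\in\mathbb{R}^d$ be vectors such that $\mathbf{t}_i-\mathbf{t}_j\notin\Lambda$ for all $i\neq j$. The set $\bigcup_{i=1}^k(\Lambda+\mathbf{t}_i)$ is called a $d$-dimensional $k$-crystal. *)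

theory Defs
  imports "HOL-Analysis.Analysis" "HOL-Library.Extended_Nat"
begin

(* A finite family is taken to be a finite set of sets.  Allowing repeated members
   (indexed families) gives the same property. *)
definition helly_property :: "'a::real_vector set \<Rightarrow> nat \<Rightarrow> bool" where
  "helly_property S n \<longleftrightarrow>
     (\<forall>\<F>. finite \<F> \<and> (\<forall>C\<in>\<F>. convex C) \<and> n \<le> card \<F> \<and>
          (\<forall>\<G>\<subseteq>\<F>. card \<G> = n \<longrightarrow> S \<inter> \<Inter>\<G> \<noteq> {})
        \<longrightarrow> S \<inter> \<Inter>\<F> \<noteq> {})"

(* Intended for non-empty S. *)
definition helly_number :: "'a::real_vector set \<Rightarrow> enat" where
  "helly_number S =
     (if \<exists>n>0. helly_property S n
      then enat (LEAST n. 0 < n \<and> helly_property S n)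
      else \<infinity>)"

(* The basis B is finite, since it is an independent set in a Euclidean space. *)
definition full_rank_lattice :: "'a::euclidean_space set \<Rightarrow> bool" where
  "full_rank_lattice \<Lambda> \<longleftrightarrow>
     (\<exists>B. independent B \<and> span B = UNIV \<and>
          \<Lambda> = {\<Sum>b\<in>B. of_int (c b) *\<^sub>R b | c :: 'a \<Rightarrow> int. True})"

definition crystal :: "nat \<Rightarrow> 'a::euclidean_space set \<Rightarrow> bool" where
  "crystal k S \<longleftrightarrow>
     (\<exists>\<Lambda> t. full_rank_lattice \<Lambda> \<and>
            (\<forall>i<k. \<forall>j<k. i \<noteq> j \<longrightarrow> t i - t j \<notin> \<Lambda>) \<and>
            S = (\<Union>i<k. (\<lambda>x. x + t i) ` \<Lambda>))"

end

theory Submission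
  imports Defs
begin

text \<open>A crystal is locally finite, and it splits into \<open>k * 2 ^ d\<close> classes (coset and parity of the
coordinates) such that the midpoint of two points of one class lies in the crystal. Suppose more than
\<open>k * 2 ^ d\<close> convex sets have no common point in \<open>S\<close> although any proper subfamily has one. Restrict
to a finite convex piece of \<open>S\<close>, enlarge the sets as far as possible, and for each set \<open>C i\<close> choose a
point \<open>p i\<close> of all the other sets that is closest to \<open>C i\<close>, in the sense that the hull of
\<open>C i\<close> and \<open>p i\<close> contains no further point of \<open>S\<close> in all the other sets. Two of these points
belong to one class, and by maximality and the anti-exchange property of convex hulls their midpoint lies in
every set of the family.\<close>

text \<open>Write \<open>x\<close> as a mixture of some \<open>c\<close> in \<open>C\<close> and
  \<open>y\<close>, and \<open>y\<close> as a mixture of some \<open>e\<close> in \<open>C\<close>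
  and \<open>x\<close>. Substituting leaves \<open>x\<close> on the right with weight
  \<open>a * b\<close>, which is below 1 since \<open>a = 1\<close> would force
  \<open>x = y\<close>. Solving for \<open>x\<close> gives a convex combination of \<open>c\<close>
  and \<open>e\<close>.\<close>

lemma convex_hull_antiexchange:
  fixes C :: "'a::real_vector set"
  assumes "convex C" "x \<noteq> y"
    and x: "x \<in> convex hull (insert y C)" and y: "y \<in> convex hull (insert x C)"
  shows "x \<in> C"
proof (cases "C = {}")
  case True
  then show ?thesis using assms by simp
next
  case False
  have hull: "convex hull C = C"
    using \<open>convex C\<close> by (rule hull_same)
  have insertD: "\<exists>a c. 0 \<le> a \<and> a \<le> 1 \<and> c \<in> C \<and> u = (1 - a) *\<^sub>R c + a *\<^sub>R v"
    if u: "u \<in> convex hull (insert v C)" for u v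
  proof -
    obtain a a' c where "0 \<le> a" "0 \<le> a'" "a + a' = 1" "c \<in> C" "u = a *\<^sub>R v + a' *\<^sub>R c"
      using u unfolding convex_hull_insert[OF False] hull by blast
    moreover from this have "a' = 1 - a" by simp
    ultimately show ?thesis
      by (intro exI[of _ a] exI[of _ c]) simp
  qed
  obtain a c where a: "0 \<le> a" "a \<le> 1" "c \<in> C" and xa: "x = (1 - a) *\<^sub>R c + a *\<^sub>R y"
    using insertD[OF x] by blast
  obtain b e where b: "0 \<le> b" "b \<le> 1" "e \<in> C" and yb: "y = (1 - b) *\<^sub>R e + b *\<^sub>R x"
    using insertD[OF y] by blast
  have "a * b \<le> a" "a * b \<le> b"
    using a b by (auto simp: mult_left_le mult_left_le_one_le)
  moreover have "\<not> (a = 1 \<and> b = 1)"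
    using xa \<open>x \<noteq> y\<close> by auto
  ultimately have ab: "a * b < 1"
    using a b by (cases "a = 1") auto
  have "x = (1 - a) *\<^sub>R c + (a * (1 - b)) *\<^sub>R e + (a * b) *\<^sub>R x"
    using xa unfolding yb by (simp add: scaleR_add_right add.assoc)
  then have eq: "(1 - a * b) *\<^sub>R x = (1 - a) *\<^sub>R c + (a * (1 - b)) *\<^sub>R e"
    by (simp add: algebra_simps)
  define u v where "u = (1 - a) / (1 - a * b)" and "v = a * (1 - b) / (1 - a * b)"
  have "x = (1 / (1 - a * b)) *\<^sub>R ((1 - a * b) *\<^sub>R x)"
    using ab by simp
  also have "\<dots> = u *\<^sub>R c + v *\<^sub>R e"
    unfolding eq u_def v_def by (simp add: scaleR_add_right)
  finally have "x = u *\<^sub>R c + v *\<^sub>R e" .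
  moreover have "0 \<le> u" "0 \<le> v"
    using a b ab by (auto simp: u_def v_def)
  moreover have "u + v = 1"
    using ab by (simp add: u_def v_def field_simps)
  ultimately show ?thesis
    using \<open>convex C\<close> a b by (simp add: convexD)
qed

text \<open>The combinatorial core: \<open>T\<close> is the finite piece of the crystal and
  \<open>g\<close> assigns classes, fewer than there are sets. Indexing the family makes it easy to
  enlarge a single member.\<close>

lemma convex_family_common_point:
  fixes C :: "'i \<Rightarrow> 'a::real_vector set" and T :: "'a set"
  assumes I: "finite I" and T: "finite T"
    and g: "g ` T \<subseteq> A" "finite A" "card A < card I"
    and mid: "\<And>x y. x \<in> T \<Longrightarrow> y \<in> T \<Longrightarrow> g x = g y \<Longrightarrow> (1/2) *\<^sub>R x + (1/2) *\<^sub>R y \<in> T"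
    and conv: "\<And>i. i \<in> I \<Longrightarrow> convex (C i)"
    and meet: "\<And>i. i \<in> I \<Longrightarrow> T \<inter> (\<Inter>j\<in>I - {i}. C j) \<noteq> {}"
  shows "T \<inter> (\<Inter>i\<in>I. C i) \<noteq> {}"
proof
  assume "T \<inter> (\<Inter>i\<in>I. C i) = {}"
  define Q where "Q C \<longleftrightarrow> (\<forall>i\<in>I. convex (C i)) \<and> T \<inter> (\<Inter>i\<in>I. C i) = {} \<and>
    (\<forall>i\<in>I. T \<inter> (\<Inter>j\<in>I - {i}. C j) \<noteq> {})" for C :: "'i \<Rightarrow> 'a set"
  \<comment> \<open>\<open>Q\<close> describes a counterexample. The size \<open>w\<close> counts
    only points of \<open>T\<close>, so it is bounded and some counterexample \<open>K\<close>
    attains its maximum.\<close>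
  define w where "w C = (\<Sum>i\<in>I. card (T \<inter> C i))" for C :: "'i \<Rightarrow> 'a set"
  have "Q C"
    using conv meet \<open>T \<inter> (\<Inter>i\<in>I. C i) = {}\<close> by (simp add: Q_def)
  moreover have "\<forall>C. Q C \<longrightarrow> w C < Suc (card I * card T)"
    unfolding w_def using T sum_bounded_above[of I "\<lambda>i. card (T \<inter> _ i)" "card T"]
    by (simp add: less_Suc_eq_le card_mono)
  ultimately obtain K where K: "Q K" and K_max: "\<And>L. Q L \<Longrightarrow> w L \<le> w K"
    using ex_has_greatest_nat[of Q C w] by blast
  define D where "D i = T \<inter> (\<Inter>j\<in>I - {i}. K j)" for i
  have convK: "convex (K i)" and D_ne: "D i \<noteq> {}" if "i \<in> I" for i
    using K that by (auto simp: Q_def D_def)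
  have D_disj: "D i \<inter> K i = {}" if "i \<in> I" for i
    using K that unfolding Q_def D_def by blast
  have finD: "finite (D i)" for i
    using T by (simp add: D_def)

  \<comment> \<open>Take \<open>p\<close> minimizing the number of points of \<open>D i\<close> in
    the hull. A second such point \<open>y\<close> would span a smaller hull, which by minimality
    still contains \<open>p\<close>; anti-exchange then puts \<open>p\<close> into
    \<open>K i\<close>.\<close>
  have "\<exists>p\<in>D i. D i \<inter> convex hull (insert p (K i)) = {p}" if i: "i \<in> I" for i
  proof -
    define r where "r p = card (D i \<inter> convex hull (insert p (K i)))" for p
    obtain p where p: "p \<in> D i" and p_min: "\<And>y. y \<in> D i \<Longrightarrow> r p \<le> r y"
      using ex_has_least_nat[of "\<lambda>p. p \<in> D i" _ r] D_ne[OF i] by blast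
    have "y = p" if y: "y \<in> D i" "y \<in> convex hull (insert p (K i))" for y
    proof (rule ccontr)
      assume "y \<noteq> p"
      have "convex hull (insert y (K i)) \<subseteq> convex hull (insert p (K i))"
        using y by (intro hull_minimal) (auto intro: hull_inc)
      then have "D i \<inter> convex hull (insert y (K i)) = D i \<inter> convex hull (insert p (K i))"
        using p_min[OF y(1)] finD unfolding r_def by (intro card_seteq) auto
      moreover have "p \<in> D i \<inter> convex hull (insert p (K i))"
        using p by (auto intro: hull_inc)
      ultimately have "p \<in> convex hull (insert y (K i))"
        by blast
      then have "p \<in> K i"
        using convex_hull_antiexchange[OF convK[OF i] _ _ y(2)] \<open>y \<noteq> p\<close> by blast
      then show False using p D_disj[OF i] by blast
    qed
    moreover have "p \<in> convex hull (insert p (K i))"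
      by (auto intro: hull_inc)
    ultimately show ?thesis using p by blast
  qed
  then obtain p where pD: "\<And>i. i \<in> I \<Longrightarrow> p i \<in> D i"
    and p: "\<And>i. i \<in> I \<Longrightarrow> D i \<inter> convex hull (insert (p i) (K i)) = {p i}"
    by metis

  have other: "p i \<in> K j" if "i \<in> I" "j \<in> I" "i \<noteq> j" for i j
    using pD that by (auto simp: D_def)
  have notin: "p i \<notin> K i" if "i \<in> I" for i
    using pD D_disj that by blast
  \<comment> \<open>Pigeonhole: there are fewer classes than indices.\<close>
  have "(\<lambda>i. g (p i)) ` I \<subseteq> A"
    using g(1) pD by (auto simp: D_def)
  then have "\<not> inj_on (\<lambda>i. g (p i)) I"
    using card_inj_on_le[OF _ _ g(2)] g(3) by (meson not_less)
  then obtain i j where ij: "i \<in> I" "j \<in> I" "i \<noteq> j" and gij: "g (p i) = g (p j)"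
    by (auto simp: inj_on_def)
  define q where "q = (1/2) *\<^sub>R p i + (1/2) *\<^sub>R p j"
  have qT: "q \<in> T"
    unfolding q_def using mid gij pD ij by (auto simp: D_def)
  \<comment> \<open>Stated for a generic pair, so that it serves both \<open>(i, j)\<close> and
    \<open>(j, i)\<close>.\<close>
  have absorb: "q \<in> K a" if a: "a \<in> I" "b \<in> I" "a \<noteq> b"
    and qab: "q = (1/2) *\<^sub>R p a + (1/2) *\<^sub>R p b" for a b
  proof (rule ccontr)
    assume "q \<notin> K a"
    have q_hull: "q \<in> convex hull (insert (p a) (K a))"
      unfolding qab using other[of b a] a
      by (intro convexD[OF convex_convex_hull]) (auto intro: hull_inc)
    \<comment> \<open>Needed for anti-exchange below; equality would give \<open>p a = p b\<close>,
      but \<open>p b\<close> lies in \<open>K a\<close> and \<open>p a\<close> does not.\<close>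
    have "q \<noteq> p a"
    proof
      assume "q = p a"
      then have "(1/2) *\<^sub>R p a + (1/2) *\<^sub>R p a = (1/2) *\<^sub>R p a + (1/2) *\<^sub>R p b"
        using qab scaleR_half_double[of "p a"] by (simp flip: scaleR_add_right)
      then have "p a = p b" by simp
      then show False using other[of b a] notin[of a] a by auto
    qed
    define L where "L = K(a := convex hull (insert q (K a)))"
    have KL: "K l \<subseteq> L l" for l
      by (auto simp: L_def intro: hull_inc)
    have "w K < w L"
      unfolding w_def
    proof (rule sum_strict_mono_ex1[OF I])
      show "\<forall>l\<in>I. card (T \<inter> K l) \<le> card (T \<inter> L l)"
        using KL T by (auto intro!: card_mono)
      have "q \<in> L a"
        by (auto simp: L_def intro: hull_inc)
      then have "T \<inter> K a \<subset> T \<inter> L a"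
        using KL[of a] qT \<open>q \<notin> K a\<close> by blast
      then show "\<exists>l\<in>I. card (T \<inter> K l) < card (T \<inter> L l)"
        using a T by (auto intro!: bexI[of _ a] psubset_card_mono)
    qed
    \<comment> \<open>Enlarging sets preserves every nonempty \<open>D l\<close>, and
      \<open>L\<close> is still convex, so \<open>L\<close> can only fail \<open>Q\<close> by having
      a common point in \<open>T\<close>.\<close>
    then have "\<not> Q L" using K_max by fastforce
    moreover have "\<forall>l\<in>I. convex (L l)"
      using convK by (simp add: L_def)
    moreover have "\<forall>l\<in>I. T \<inter> (\<Inter>j\<in>I - {l}. L j) \<noteq> {}"
    proof
      fix l assume "l \<in> I"
      moreover have "D l \<subseteq> T \<inter> (\<Inter>j\<in>I - {l}. L j)"
        unfolding D_def using KL by (intro Int_mono INF_mono) auto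
      ultimately show "T \<inter> (\<Inter>j\<in>I - {l}. L j) \<noteq> {}"
        using D_ne by blast
    qed
    ultimately have "T \<inter> (\<Inter>l\<in>I. L l) \<noteq> {}"
      by (simp add: Q_def)
    then obtain y where y: "y \<in> T" "\<And>l. l \<in> I \<Longrightarrow> y \<in> L l" by blast
    \<comment> \<open>Only the set at \<open>a\<close> was changed, so \<open>y\<close> lies in all
      the other original sets. By the choice of \<open>p a\<close>, this forces
      \<open>y = p a\<close>, and anti-exchange between \<open>p a\<close> and \<open>q\<close>
      gives the contradiction.\<close>
    have yD: "y \<in> D a"
      unfolding D_def
    proof (intro IntI INT_I y(1))
      show "y \<in> K l" if "l \<in> I - {a}" for l
        using y(2)[of l] that by (simp add: L_def)
    qed
    have yL: "y \<in> convex hull (insert q (K a))"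
      using y(2)[OF a(1)] by (simp add: L_def)
    also have "\<dots> \<subseteq> convex hull (insert (p a) (K a))"
      using q_hull by (intro hull_minimal) (auto intro: hull_inc)
    finally have "y = p a"
      using p[OF a(1)] yD by blast
    then have "p a \<in> K a"
      using convex_hull_antiexchange[OF convK[OF a(1)], of "p a" q] yL q_hull \<open>q \<noteq> p a\<close> by auto
    then show False using notin[OF a(1)] by blast
  qed
  have "q \<in> K l" if l: "l \<in> I" for l
  proof (cases "l = i \<or> l = j")
    case True
    then show ?thesis
      using absorb[of i j] absorb[of j i] ij by (auto simp: q_def add.commute)
  next
    case False
    then show ?thesis
      unfolding q_def using other[of i l] other[of j l] ij l
      by (intro convexD[OF convK]) auto
  qed
  then show False using K qT by (auto simp: Q_def)
qed

text \<open>Induction on the size of the family, starting at \<open>N\<close>: for a larger family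
  the induction hypothesis gives common points after removing any one member, which is what the
  finite result requires.\<close>

lemma helly_property_if_midpoint_classes:
  fixes S :: "'a::euclidean_space set"
  assumes fin: "\<And>X. bounded X \<Longrightarrow> finite (S \<inter> X)"
    and g: "g ` S \<subseteq> A" "finite A" "card A = N"
    and mid: "\<And>x y. x \<in> S \<Longrightarrow> y \<in> S \<Longrightarrow> g x = g y \<Longrightarrow> (1/2) *\<^sub>R x + (1/2) *\<^sub>R y \<in> S"
  shows "helly_property S N"
proof -
  have "S \<inter> \<Inter>\<F> \<noteq> {}"
    if "finite \<F>" "\<forall>C\<in>\<F>. convex C" "N \<le> card \<F>"
      "\<forall>\<G>\<subseteq>\<F>. card \<G> = N \<longrightarrow> S \<inter> \<Inter>\<G> \<noteq> {}" for \<F> :: "'a set set"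
    using that
  proof (induction "card \<F>" arbitrary: \<F> rule: less_induct)
    case less
    show ?case
    proof (cases "card \<F> = N")
      case True
      then show ?thesis using less.prems by blast
    next
      case False
      then have N: "N < card \<F>" using less.prems by simp
      have "S \<inter> \<Inter>(\<F> - {C}) \<noteq> {}" if C: "C \<in> \<F>" for C
      proof (rule less.hyps)
        show "card (\<F> - {C}) < card \<F>"
          using less.prems C by (meson card_Diff1_less)
        show "N \<le> card (\<F> - {C})"
          using C N less.prems by simp
      qed (use less.prems in \<open>auto\<close>)
      then have "\<forall>C\<in>\<F>. \<exists>x. x \<in> S \<inter> \<Inter>(\<F> - {C})" by blast
      then obtain f where f: "\<And>C. C \<in> \<F> \<Longrightarrow> f C \<in> S \<inter> \<Inter>(\<F> - {C})" by metis
      \<comment> \<open>The hull of the witnesses is bounded, so \<open>T\<close> is finite; it is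
        convex, so midpoints within a class stay in \<open>T\<close>.\<close>
      define T where "T = S \<inter> convex hull (f ` \<F>)"
      have "T \<inter> (\<Inter>C\<in>\<F>. C) \<noteq> {}"
      proof (rule convex_family_common_point[where g = g and A = A])
        show "finite T"
          unfolding T_def using less.prems
          by (intro fin bounded_convex_hull finite_imp_bounded) auto
        show "(1/2) *\<^sub>R x + (1/2) *\<^sub>R y \<in> T" if "x \<in> T" "y \<in> T" "g x = g y" for x y
          using that mid convexD[OF convex_convex_hull, of x "f ` \<F>" y "1/2" "1/2"]
          by (auto simp: T_def)
        show "T \<inter> (\<Inter>j\<in>\<F> - {C}. j) \<noteq> {}" if C: "C \<in> \<F>" for C
        proof -
          have "f C \<in> T"
            using f[OF C] C by (auto simp: T_def intro: hull_inc)
          then show ?thesis using f[OF C] by auto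
        qed
      qed (use less.prems g N in \<open>auto simp: T_def\<close>)
      then show ?thesis by (auto simp: T_def)
    qed
  qed
  then show ?thesis by (auto simp: helly_property_def)
qed

text \<open>Coordinates with respect to \<open>B\<close> are linear, hence bounded on
  \<open>X\<close>, which leaves finitely many integer values for each.\<close>

lemma finite_lattice_Int_bounded:
  fixes B :: "'a::euclidean_space set"
  assumes B: "independent B" "span B = UNIV" and X: "bounded X"
  shows "finite ({\<Sum>b\<in>B. of_int (c b) *\<^sub>R b | c :: 'a \<Rightarrow> int. True} \<inter> X)"
proof -
  have finB: "finite B" using B(1) by (rule independent_imp_finite)
  have "\<exists>M. \<forall>x\<in>X. \<bar>representation B x b\<bar> \<le> M" for b
  proof -
    have "linear (\<lambda>x. representation B x b)"
      by (rule linearI) (use B in \<open>auto simp: representation_add representation_scale\<close>)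
    then have "bounded ((\<lambda>x. representation B x b) ` X)"
      using X by (intro bounded_linear_image) (auto simp: linear_conv_bounded_linear)
    then show ?thesis by (auto simp: bounded_iff)
  qed
  then obtain M where M: "\<And>b x. x \<in> X \<Longrightarrow> \<bar>representation B x b\<bar> \<le> M b"
    by metis
  \<comment> \<open>Extensional functions make the box finite: values of \<open>c\<close> outside
    \<open>B\<close> do not affect the sum, so \<open>c\<close> may be replaced by its
    restriction.\<close>
  define P where "P = (\<Pi>\<^sub>E b\<in>B. {- \<lceil>M b\<rceil> .. \<lceil>M b\<rceil>})"
  have "x \<in> (\<lambda>c. \<Sum>b\<in>B. of_int (c b) *\<^sub>R b) ` P"
    if "x \<in> X" and x: "x = (\<Sum>b\<in>B. of_int (c b) *\<^sub>R b)" for x and c :: "'a \<Rightarrow> int"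
  proof
    have rep: "representation B x b = of_int (c b)" if b: "b \<in> B" for b
    proof -
      have "representation B x b = (\<Sum>b'\<in>B. of_int (c b') * (if b' = b then 1 else 0))"
        unfolding x using B
        by (auto simp: representation_sum representation_scale representation_basis intro!: sum.cong)
      also have "\<dots> = (\<Sum>b'\<in>B. if b' = b then of_int (c b') else 0)"
        by (intro sum.cong) auto
      finally show ?thesis using b finB by simp
    qed
    have "- \<lceil>M b\<rceil> \<le> c b \<and> c b \<le> \<lceil>M b\<rceil>" if "b \<in> B" for b
      using M[OF \<open>x \<in> X\<close>, of b] rep[OF that] by linarith
    then show "restrict c B \<in> P" by (auto simp: P_def)
    show "x = (\<Sum>b\<in>B. of_int (restrict c B b) *\<^sub>R b)"
      unfolding x by simp
  qed
  then have "{\<Sum>b\<in>B. of_int (c b) *\<^sub>R b | c :: 'a \<Rightarrow> int. True} \<inter> X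
      \<subseteq> (\<lambda>c. \<Sum>b\<in>B. of_int (c b) *\<^sub>R b) ` P" by blast
  moreover have "finite P"
    unfolding P_def using finB by (intro finite_PiE) auto
  ultimately show ?thesis by (meson finite_imageI finite_subset)
qed

lemma helly_property_crystal:
  fixes S :: "'a::euclidean_space set"
  assumes "crystal k S"
  shows "helly_property S (k * 2 ^ DIM('a))"
proof -
  obtain \<Lambda> and t :: "nat \<Rightarrow> 'a" where "full_rank_lattice \<Lambda>"
    and S: "S = (\<Union>i<k. (\<lambda>x. x + t i) ` \<Lambda>)"
    using assms unfolding crystal_def by blast
  then obtain B :: "'a set" where B: "independent B" "span B = UNIV"
    and L: "\<Lambda> = {\<Sum>b\<in>B. of_int (c b) *\<^sub>R b | c :: 'a \<Rightarrow> int. True}"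
    unfolding full_rank_lattice_def by blast
  have finB: "finite B" using B(1) by (rule independent_imp_finite)
  have cardB: "card B = DIM('a)"
    using dim_eq_card[of B UNIV] B by simp
  have "\<exists>i c. i < k \<and> x = (\<Sum>b\<in>B. of_int (c b) *\<^sub>R b) + t i" if "x \<in> S" for x
    using that unfolding S L by blast
  then obtain n and c :: "'a \<Rightarrow> 'a \<Rightarrow> int" where nk: "\<And>x. x \<in> S \<Longrightarrow> n x < k"
    and x: "\<And>x. x \<in> S \<Longrightarrow> x = (\<Sum>b\<in>B. of_int (c x b) *\<^sub>R b) + t (n x)"
    by metis
  \<comment> \<open>The class of a point is its chosen translate together with its coefficients mod
    2, encoded as a subset of \<open>B\<close>; this yields the count
    \<open>k * 2 ^ DIM('a)\<close>.\<close>
  define g where "g x = (n x, {b \<in> B. odd (c x b)})" for x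
  show ?thesis
  proof (rule helly_property_if_midpoint_classes)
    show "g ` S \<subseteq> {..<k} \<times> Pow B"
      using nk by (auto simp: g_def)
    show "finite ({..<k} \<times> Pow B)" "card ({..<k} \<times> Pow B) = k * 2 ^ DIM('a)"
      using finB cardB by (auto simp: card_cartesian_product card_Pow)
    show "finite (S \<inter> X)" if X: "bounded X" for X
    proof -
      \<comment> \<open>Each coset is handled by translating \<open>X\<close> back to the
        lattice.\<close>
      have "finite (\<Lambda> \<inter> (\<lambda>x. - t i + x) ` X)" for i
        unfolding L using B bounded_translation[OF X] by (intro finite_lattice_Int_bounded)
      moreover have "S \<inter> X \<subseteq> (\<Union>i<k. (\<lambda>x. x + t i) ` (\<Lambda> \<inter> (\<lambda>x. - t i + x) ` X))"
        unfolding S by (force simp: image_iff)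
      ultimately show ?thesis by (meson finite_UN finite_imageI finite_lessThan finite_subset)
    qed
    show "(1/2) *\<^sub>R y + (1/2) *\<^sub>R z \<in> S" if y: "y \<in> S" and z: "z \<in> S" and "g y = g z" for y z
    proof -
      from \<open>g y = g z\<close> have n: "n z = n y" and par: "\<And>b. b \<in> B \<Longrightarrow> even (c y b + c z b)"
        by (auto simp: g_def)
      \<comment> \<open>Equal parities make the integer division exact, so the midpoint has integer
        coefficients; the two halves of the common translate add up to it.\<close>
      have half: "of_int ((c y b + c z b) div 2) = (1/2) * (of_int (c y b) + of_int (c z b) :: real)"
        if "b \<in> B" for b
        using par[OF that] by (simp add: real_of_int_div)
      have "(1/2) *\<^sub>R y + (1/2) *\<^sub>R z
        = (1/2) *\<^sub>R ((\<Sum>b\<in>B. of_int (c y b) *\<^sub>R b) + (\<Sum>b\<in>B. of_int (c z b) *\<^sub>R b))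
          + ((1/2) *\<^sub>R t (n y) + (1/2) *\<^sub>R t (n y))"
        by (subst x[OF y], subst x[OF z]) (simp add: n scaleR_add_right algebra_simps)
      also have "(1/2) *\<^sub>R t (n y) + (1/2) *\<^sub>R t (n y) = t (n y)"
        by (simp flip: scaleR_add_left)
      also have "(1/2) *\<^sub>R ((\<Sum>b\<in>B. of_int (c y b) *\<^sub>R b) + (\<Sum>b\<in>B. of_int (c z b) *\<^sub>R b))
        = (\<Sum>b\<in>B. of_int ((c y b + c z b) div 2) *\<^sub>R b)"
        unfolding sum.distrib[symmetric] scaleR_sum_right
        by (intro sum.cong refl) (simp only: half scaleR_scaleR scaleR_add_left[symmetric])
      finally show ?thesis
        using nk[OF y] unfolding S L by (auto intro!: bexI[of _ "n y"] exI)
    qed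
  qed
qed

theorem corollary3p3:
  fixes S :: "(real ^ 'd) set" and k :: nat
  assumes "k \<ge> 1"
    and "crystal k S"
  shows "helly_number S \<le> enat (k * 2 ^ CARD('d))"
proof -
  let ?P = "\<lambda>n. 0 < n \<and> helly_property S n"
  \<comment> \<open>Here \<open>k \<ge> 1\<close> supplies the positivity that the minimum
    demands.\<close>
  have P: "?P (k * 2 ^ CARD('d))"
    using assms helly_property_crystal[of k S] by simp
  then have "helly_number S = enat (LEAST n. ?P n)"
    unfolding helly_number_def by (intro if_P exI)
  then show ?thesis
    using Least_le[of ?P, OF P] by simp
qed

end
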